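(* Let $f:\mathbb{R}^m\times\mathbb{R}^n\to\mathbb{R}$ satisfy the standing assumptions (continuously differentiable, convex-concave, Lipschitz partial gradients with constant $L$ as defined in the context, and nonempty set of saddle points), and let $F(z)=[\nabla_x f(x,y);-\nabla_y f(x,y)]$ for $z=[x;y]\in\mathbb{R}^{m+n}$. Let $(z_k)$ be generated by the OGDA method $$z_{k+1}=z_k-2\eta F(z_k)+\eta F(z_{k-1}),\qquad k\ge 0,$$ with initial condition $z_0=z_{-1}$, and suppose $0<\eta\le\frac{1}{2L}$. Then: (a) For every $z\in\mathbb{R}^{m+n}$ and every $k\ge 0$, $$F(z_{k+1})^\top(z_{k+1}-z)\le\frac{1}{2\eta}\|z_k-z\|^2-\frac{1}{2\eta}\|z_{k+1}-z\|^2-\frac L2\|z_{k+1}-z_k\|^2+\frac L2\|z_k-z_{k-1}\|^2$$ $$\qquad+(F(z_{k+1})-F(z_k))^\top(z_{k+1}-z)-(F(z_k)-F(z_{k-1}))^\top(z_k-z).$$ (b) For any saddle point $z^*=(x^*,y^* )$ of $f$, the iterates $z_k=(x_k,y_k)$ stay within the compact set $$\mathcal{D}:=\{(x,y):\|x-x^*\|^2+\|y-y^*\|^2\le 2(\|x_0-x^*\|^2+\|y_0-y^*\|^2)\}.$$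
   Context: Norms are Euclidean. A saddle point of $f$ is a pair $(x^*,y^* )\in\mathbb{R}^m\times\mathbb{R}^n$ with $f(x^*,y)\le f(x^*,y^* )\le f(x,y^* )$ for all $x\in\mathbb{R}^m$, $y\in\mathbb{R}^n$. Standing assumptions on $f$: (1) $f$ is continuously differentiable in $x$ and $y$; $f(\cdot,y)$ is convex for every $y\in\mathbb{R}^n$ and $f(x,\cdot)$ is concave for every $x\in\mathbb{R}^m$. (2) There are constants $L_{xx},L_{xy},L_{yx},L_{yy}$ such that for all arguments $\|\nabla_x f(x_1,y)-\nabla_x f(x_2,y)\|\le L_{xx}\|x_1-x_2\|$, $\|\nabla_x f(x,y_1)-\nabla_x f(x,y_2)\|\le L_{xy}\|y_1-y_2\|$, $\|\nabla_y f(x,y_1)-\nabla_y f(x,y_2)\|\le L_{yy}\|y_1-y_2\|$, $\|\nabla_y f(x_1,y)-\nabla_y f(x_2,y)\|\le L_{yx}\|x_1-x_2\|$; and $L:=2\max\{L_{xx},L_{xy},L_{yx},L_{yy}\}$. (3) The set $\mathcal{Z}^*$ of saddle points of $f$ is nonempty. *)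

theory Defs
  imports "HOL-Analysis.Analysis"
begin

definition gradient :: "('a::real_inner \<Rightarrow> real) \<Rightarrow> 'a \<Rightarrow> 'a" where
  "gradient g x = (THE D. GDERIV g x :> D)"

lemma gradient_eqI:
  assumes "GDERIV g x :> D"
  shows "gradient g x = D"
  unfolding gradient_def
proof (rule the_equality)
  show "GDERIV g x :> D" by fact
next
  fix D' assume "GDERIV g x :> D'"
  with assms have "(\<lambda>h. inner h D') = (\<lambda>h. inner h D)"
    unfolding gderiv_def by (rule has_derivative_unique[rotated])
  then have "\<And>h. inner h D' = inner h D" by meson
  then show "D' = D" by (metis vector_eq_ldot)
qed

lemma GDERIV_gradient:
  fixes g :: "'a::euclidean_space \<Rightarrow> real"
  assumes "g differentiable (at x)"
  shows "GDERIV g x :> gradient g x"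
proof -
  obtain g' where g': "(g has_derivative g') (at x)"
    using assms by (auto simp: differentiable_def)
  interpret linear g' using g' by (rule has_derivative_linear)
  define D where "D = (\<Sum>b\<in>Basis. g' b *\<^sub>R b)"
  have "g' h = inner h D" for h
  proof -
    have "g' h = g' (\<Sum>b\<in>Basis. inner h b *\<^sub>R b)"
      by (simp add: euclidean_representation)
    also have "\<dots> = (\<Sum>b\<in>Basis. inner h b *\<^sub>R g' b)"
      by (simp add: sum scale)
    finally show ?thesis
      by (simp add: D_def inner_sum_right mult.commute)
  qed
  then have "g' = (\<lambda>h. inner h D)" by auto
  with g' have "GDERIV g x :> D" by (simp add: gderiv_def)
  with gradient_eqI[OF this] show ?thesis by simp
qed

definition grad_x :: "('a::real_inner \<times> 'b \<Rightarrow> real) \<Rightarrow> 'a \<Rightarrow> 'b \<Rightarrow> 'a" where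
  "grad_x f x y = gradient (\<lambda>u. f (u, y)) x"

definition grad_y :: "('a \<times> 'b::real_inner \<Rightarrow> real) \<Rightarrow> 'a \<Rightarrow> 'b \<Rightarrow> 'b" where
  "grad_y f x y = gradient (\<lambda>v. f (x, v)) y"

(* The partial gradients exist everywhere and are jointly continuous. *)
definition continuously_differentiable ::
  "('a::euclidean_space \<times> 'b::euclidean_space \<Rightarrow> real) \<Rightarrow> bool" where
  "continuously_differentiable f \<longleftrightarrow>
     (\<forall>x y. (\<lambda>u. f (u, y)) differentiable (at x)) \<and>
     (\<forall>x y. (\<lambda>v. f (x, v)) differentiable (at y)) \<and>
     continuous_on UNIV (\<lambda>(x, y). grad_x f x y) \<and>
     continuous_on UNIV (\<lambda>(x, y). grad_y f x y)"

definition convex_concave ::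
  "('a::real_vector \<times> 'b::real_vector \<Rightarrow> real) \<Rightarrow> bool" where
  "convex_concave f \<longleftrightarrow>
     (\<forall>y. convex_on UNIV (\<lambda>x. f (x, y))) \<and> (\<forall>x. concave_on UNIV (\<lambda>y. f (x, y)))"

definition saddle_points :: "('a \<times> 'b \<Rightarrow> real) \<Rightarrow> ('a \<times> 'b) set" where
  "saddle_points f =
     {(xs, ys). \<forall>x y. f (xs, y) \<le> f (xs, ys) \<and> f (xs, ys) \<le> f (x, ys)}"

(* R^(m+n) is the product type: its library norm is
   norm (x, y) = sqrt (norm x ^ 2 + norm y ^ 2), with the matching inner product. *)
definition saddle_operator ::
  "('a::real_inner \<times> 'b::real_inner \<Rightarrow> real) \<Rightarrow> 'a \<times> 'b \<Rightarrow> 'a \<times> 'b" where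
  "saddle_operator f z = (grad_x f (fst z) (snd z), - grad_y f (fst z) (snd z))"

(* Integer indices, so that the initial condition can refer to z (-1);
   z is unconstrained below -1. *)
definition ogda_iterates ::
  "('a::real_inner \<times> 'b::real_inner \<Rightarrow> real) \<Rightarrow> real \<Rightarrow> (int \<Rightarrow> 'a \<times> 'b) \<Rightarrow> bool" where
  "ogda_iterates f \<eta> z \<longleftrightarrow>
     z 0 = z (-1) \<and>
     (\<forall>k\<ge>0. z (k + 1) = z k - (2 * \<eta>) *\<^sub>R saddle_operator f (z k)
                              + \<eta> *\<^sub>R saddle_operator f (z (k - 1)))"

end

theory Submission
  imports Defs
begin

text \<open>
  OGDA is an inexact proximal point method: with
  \<open>d\<^sub>k = F z\<^sub>k - F z\<^bsub>k-1\<^esub>\<close>, the recursion is the implicit step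
  \<open>z\<^bsub>k+1\<^esub> = z\<^sub>k - \<eta> F z\<^bsub>k+1\<^esub>\<close> up to the error
  \<open>\<eta> (d\<^bsub>k+1\<^esub> - d\<^sub>k)\<close>. Pairing it with \<open>z\<^bsub>k+1\<^esub> - w\<close>, the implicit step yields the
  difference of squared distances by the polarization identity, while the error is a difference of
  the terms \<open>d\<^sub>k \<bullet> (z\<^sub>k - w)\<close> up to \<open>- d\<^sub>k \<bullet> (z\<^bsub>k+1\<^esub> - z\<^sub>k)\<close>. This remainder costs, by the
  Lipschitz bound on \<open>F\<close>, at most
  \<open>L / 2 * \<parallel>z\<^sub>k - z\<^bsub>k-1\<^esub>\<parallel>\<^sup>2 + L / 2 * \<parallel>z\<^bsub>k+1\<^esub> - z\<^sub>k\<parallel>\<^sup>2\<close>; the second part is absorbed by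
  \<open>- \<parallel>z\<^bsub>k+1\<^esub> - z\<^sub>k\<parallel>\<^sup>2 / (2 \<eta>)\<close>, because \<open>L \<le> 1 / (2 \<eta>)\<close>. This is part (a)
  (lemma \<open>ogda_step_inequality\<close>).

  For part (b), choose \<open>w\<close> to be a saddle point. By the tangent inequalities for a convex-concave
  function, \<open>F z \<bullet> (z - w) \<ge> 0\<close> for all \<open>z\<close>, so (a) says that the energy
  \<open>\<parallel>z\<^sub>k - w\<parallel>\<^sup>2 / (2 \<eta>) + L / 2 * \<parallel>z\<^sub>k - z\<^bsub>k-1\<^esub>\<parallel>\<^sup>2 - d\<^sub>k \<bullet> (z\<^sub>k - w)\<close>
  never increases. Its start value is \<open>\<parallel>z\<^sub>0 - w\<parallel>\<^sup>2 / (2 \<eta>)\<close> since \<open>z\<^sub>0 = z\<^bsub>-1\<^esub>\<close>, and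
  a second use of the Lipschitz bound shows that it is at least
  \<open>\<parallel>z\<^sub>k - w\<parallel>\<^sup>2 / (4 \<eta>)\<close> (lemma \<open>ogda_dist_bound\<close>). The two bounds differ by the
  factor 2 that defines the compact set.
\<close>

text \<open>Restricting to the line through the two points reduces this to one real variable.\<close>

lemma convex_on_GDERIV_above_tangent:
  fixes g :: "'a::real_inner \<Rightarrow> real"
  assumes conv: "convex_on UNIV g" and deriv: "GDERIV g x :> D"
  shows "g u - g x \<ge> D \<bullet> (u - x)"
proof -
  define h where "h t = g (x + t *\<^sub>R (u - x))" for t :: real
  have "convex_on UNIV h"
  proof (rule convex_onI)
    fix t a b :: real assume t: "0 < t" "t < 1"
    have "x + ((1 - t) *\<^sub>R a + t *\<^sub>R b) *\<^sub>R (u - x)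
        = (1 - t) *\<^sub>R (x + a *\<^sub>R (u - x)) + t *\<^sub>R (x + b *\<^sub>R (u - x))"
      by (simp add: algebra_simps)
    then show "h ((1 - t) *\<^sub>R a + t *\<^sub>R b) \<le> (1 - t) * h a + t * h b"
      using convex_onD[OF conv, of t "x + a *\<^sub>R (u - x)" "x + b *\<^sub>R (u - x)"] t
      by (simp add: h_def)
  qed simp
  moreover have "(h has_real_derivative D \<bullet> (u - x)) (at 0)"
  proof -
    have line: "((\<lambda>t. x + t *\<^sub>R (u - x)) has_derivative (\<lambda>t. t *\<^sub>R (u - x))) (at (0::real))"
      by (auto intro!: derivative_eq_intros)
    have "(g has_derivative (\<lambda>v. v \<bullet> D)) (at (x + 0 *\<^sub>R (u - x)))"
      using deriv by (simp add: gderiv_def)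
    from has_derivative_compose[OF line this]
    show ?thesis
      by (simp add: h_def[abs_def] has_field_derivative_def mult_commute_abs inner_commute)
  qed
  ultimately have "h 1 - h 0 \<ge> (D \<bullet> (u - x)) * (1 - 0)"
    by (intro convex_on_imp_above_tangent[where A = UNIV]) auto
  then show ?thesis by (simp add: h_def)
qed

text \<open>
  The tangent inequalities in the two variables bound the left-hand side below by
  \<open>f (x, ys) - f (xs, y)\<close>, and the value at the saddle point lies between these two numbers.
\<close>

lemma saddle_operator_inner_saddle_point_nonneg:
  fixes f :: "'a::euclidean_space \<times> 'b::euclidean_space \<Rightarrow> real"
  assumes diff: "continuously_differentiable f" and cc: "convex_concave f"
    and saddle: "(xs, ys) \<in> saddle_points f"
  shows "0 \<le> saddle_operator f p \<bullet> (p - (xs, ys))"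
proof -
  obtain x y where p: "p = (x, y)" by (cases p)
  have dx: "GDERIV (\<lambda>u. f (u, y)) x :> grad_x f x y"
    unfolding grad_x_def
    using diff by (intro GDERIV_gradient) (simp add: continuously_differentiable_def)
  have dy: "GDERIV (\<lambda>v. f (x, v)) y :> grad_y f x y"
    unfolding grad_y_def
    using diff by (intro GDERIV_gradient) (simp add: continuously_differentiable_def)
  have dy': "GDERIV (\<lambda>v. - f (x, v)) y :> - grad_y f x y"
    by (rule GDERIV_minus[OF dy])
  have "f (xs, y) - f (x, y) \<ge> grad_x f x y \<bullet> (xs - x)"
    using cc by (intro convex_on_GDERIV_above_tangent[OF _ dx]) (simp add: convex_concave_def)
  moreover have "- f (x, ys) - (- f (x, y)) \<ge> (- grad_y f x y) \<bullet> (ys - y)"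
    using cc by (intro convex_on_GDERIV_above_tangent[OF _ dy'])
      (simp add: convex_concave_def concave_on_def)
  moreover have "f (xs, y) \<le> f (x, ys)"
    using saddle unfolding saddle_points_def by (auto intro: order_trans)
  ultimately show ?thesis
    by (simp add: p saddle_operator_def inner_diff_right)
qed

text \<open>
  Each component of the difference is at most \<open>M * (a + b)\<close>, where \<open>a\<close> and \<open>b\<close> are the
  distances in the two variables. The factor 2 comes from \<open>2 * (a + b)\<^sup>2 \<le> 4 * (a\<^sup>2 + b\<^sup>2)\<close>.
\<close>

lemma saddle_operator_lipschitz:
  fixes f :: "'a::real_inner \<times> 'b::real_inner \<Rightarrow> real"
  assumes xx: "\<And>x1 x2 y. norm (grad_x f x1 y - grad_x f x2 y) \<le> M * norm (x1 - x2)"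
    and xy: "\<And>x y1 y2. norm (grad_x f x y1 - grad_x f x y2) \<le> M * norm (y1 - y2)"
    and yy: "\<And>x y1 y2. norm (grad_y f x y1 - grad_y f x y2) \<le> M * norm (y1 - y2)"
    and yx: "\<And>x1 x2 y. norm (grad_y f x1 y - grad_y f x2 y) \<le> M * norm (x1 - x2)"
    and M: "0 \<le> M"
  shows "norm (saddle_operator f p - saddle_operator f q) \<le> 2 * M * norm (p - q)"
proof -
  obtain x1 y1 x2 y2 where pq: "p = (x1, y1)" "q = (x2, y2)" by (cases p, cases q)
  define a b where "a = norm (x1 - x2)" and "b = norm (y1 - y2)"
  define gx gy where "gx = grad_x f x1 y1 - grad_x f x2 y2"
    and "gy = grad_y f x1 y1 - grad_y f x2 y2"
  have "gx = (grad_x f x1 y1 - grad_x f x2 y1) + (grad_x f x2 y1 - grad_x f x2 y2)"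
    by (simp add: gx_def)
  then have "norm gx \<le> M * (a + b)"
    using norm_triangle_le[OF add_mono[OF xx[of x1 y1 x2] xy[of x2 y1 y2]]]
    by (simp add: a_def b_def distrib_left)
  moreover have "gy = (grad_y f x1 y1 - grad_y f x2 y1) + (grad_y f x2 y1 - grad_y f x2 y2)"
    by (simp add: gy_def)
  then have "norm gy \<le> M * (a + b)"
    using norm_triangle_le[OF add_mono[OF yx[of x1 y1 x2] yy[of x2 y1 y2]]]
    by (simp add: a_def b_def distrib_left)
  ultimately have "(norm gx)\<^sup>2 + (norm gy)\<^sup>2 \<le> (M * (a + b))\<^sup>2 + (M * (a + b))\<^sup>2"
    by (intro add_mono power_mono) auto
  also have "\<dots> = M\<^sup>2 * (2 * (a + b)\<^sup>2)"
    by (simp add: power_mult_distrib)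
  also have "\<dots> \<le> M\<^sup>2 * (4 * (a\<^sup>2 + b\<^sup>2))"
    using sum_squares_bound[of a b]
    by (intro mult_left_mono) (simp_all add: power2_sum)
  also have "\<dots> = (2 * M * norm (p - q))\<^sup>2"
    by (simp add: pq norm_Pair a_def b_def power_mult_distrib)
  finally have "(norm (saddle_operator f p - saddle_operator f q))\<^sup>2 \<le> (2 * M * norm (p - q))\<^sup>2"
    by (simp add: pq saddle_operator_def norm_Pair gx_def gy_def norm_minus_commute)
  then show ?thesis
    by (rule power2_le_imp_le) (simp add: M)
qed

text \<open>
  Cauchy--Schwarz and \<open>2 a b \<le> a\<^sup>2 + b\<^sup>2\<close>. Splitting the product evenly matches the weight
  \<open>L / 2\<close> of the squared step lengths in the energy.
\<close>

lemma inner_lipschitz_diff_bound: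
  fixes F :: "'a::real_inner \<Rightarrow> 'a"
  assumes lip: "norm (F p - F q) \<le> L * norm (p - q)" and L: "0 \<le> L"
  shows "\<bar>(F p - F q) \<bullet> v\<bar> \<le> L / 2 * (norm (p - q))\<^sup>2 + L / 2 * (norm v)\<^sup>2"
proof -
  have "\<bar>(F p - F q) \<bullet> v\<bar> \<le> norm (F p - F q) * norm v"
    by (rule Cauchy_Schwarz_ineq2)
  also have "\<dots> \<le> L * norm (p - q) * norm v"
    by (intro mult_right_mono lip norm_ge_zero)
  also have "\<dots> = L / 2 * (2 * norm (p - q) * norm v)"
    by simp
  also have "\<dots> \<le> L / 2 * ((norm (p - q))\<^sup>2 + (norm v)\<^sup>2)"
    using L by (intro mult_left_mono sum_squares_bound) simp
  finally show ?thesis by (simp add: distrib_left)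
qed

text \<open>
  The implicit form of the step expresses \<open>F r\<close> through \<open>p - r\<close> and the two increments of \<open>F\<close>.
  Everything is then an identity, except for replacing \<open>- (F p - F q) \<bullet> (r - p)\<close> by its bound,
  half of which \<open>- \<parallel>r - p\<parallel>\<^sup>2 / (2 \<eta>)\<close> absorbs. Bounding \<open>L\<close> instead of \<open>\<eta>\<close> covers
  constant operators, where \<open>L = 0\<close>.
\<close>

lemma ogda_step_inequality:
  fixes F :: "'a::real_inner \<Rightarrow> 'a"
  assumes lip: "\<And>p q. norm (F p - F q) \<le> L * norm (p - q)" and L: "0 \<le> L"
    and \<eta>: "0 < \<eta>" "L \<le> 1 / (2 * \<eta>)"
    and step: "r = p - (2 * \<eta>) *\<^sub>R F p + \<eta> *\<^sub>R F q"
  shows "F r \<bullet> (r - w) \<le>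
           1 / (2 * \<eta>) * (norm (p - w))\<^sup>2 - 1 / (2 * \<eta>) * (norm (r - w))\<^sup>2
           - L / 2 * (norm (r - p))\<^sup>2 + L / 2 * (norm (p - q))\<^sup>2
           + (F r - F p) \<bullet> (r - w) - (F p - F q) \<bullet> (p - w)"
proof -
  have "(1 / \<eta>) *\<^sub>R (p - r) = 2 *\<^sub>R F p - F q"
    using \<eta>(1) by (simp add: step scaleR_diff_right scaleR_add_right algebra_simps)
  then have "F r = (1 / \<eta>) *\<^sub>R (p - r) + (F r - F p) - (F p - F q)"
    by (simp add: scaleR_2)
  then have "F r \<bullet> (r - w)
      = ((1 / \<eta>) *\<^sub>R (p - r) + (F r - F p) - (F p - F q)) \<bullet> (r - w)"
    by (rule arg_cong)
  also have "\<dots> = 1 / \<eta> * ((p - r) \<bullet> (r - w)) + (F r - F p) \<bullet> (r - w)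
      - (F p - F q) \<bullet> (p - w) - (F p - F q) \<bullet> (r - p)"
    by (simp add: inner_diff_left inner_diff_right inner_add_left diff_divide_distrib)
  also have "1 / \<eta> * ((p - r) \<bullet> (r - w))
      = 1 / (2 * \<eta>) * ((norm (p - w))\<^sup>2 - (norm (r - w))\<^sup>2 - (norm (r - p))\<^sup>2)"
    using \<eta>(1)
    by (simp add: power2_norm_eq_inner inner_diff_left inner_diff_right inner_commute field_simps)
  finally have eq: "F r \<bullet> (r - w) = 1 / (2 * \<eta>) * (norm (p - w))\<^sup>2
      - 1 / (2 * \<eta>) * (norm (r - w))\<^sup>2 - 1 / (2 * \<eta>) * (norm (r - p))\<^sup>2
      + (F r - F p) \<bullet> (r - w) - (F p - F q) \<bullet> (p - w) - (F p - F q) \<bullet> (r - p)"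
    by (simp only: right_diff_distrib)
  have "L * (norm (r - p))\<^sup>2 \<le> 1 / (2 * \<eta>) * (norm (r - p))\<^sup>2"
    by (intro mult_right_mono \<eta>(2)) simp
  moreover have "- ((F p - F q) \<bullet> (r - p)) \<le> L / 2 * (norm (p - q))\<^sup>2 + L / 2 * (norm (r - p))\<^sup>2"
    using inner_lipschitz_diff_bound[of F p q L "r - p", OF lip L] by linarith
  ultimately show ?thesis unfolding eq by linarith
qed

text \<open>
  The energy \<open>E\<close> does not increase, because \<open>F p \<bullet> (p - w) \<ge> 0\<close>, and it starts from its
  distance term alone. Its last term is the only one that can be negative, and costs at most its
  middle term and half of the distance term.
\<close>

lemma ogda_dist_bound:
  fixes F :: "'a::real_inner \<Rightarrow> 'a" and z :: "int \<Rightarrow> 'a"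
  assumes lip: "\<And>p q. norm (F p - F q) \<le> L * norm (p - q)" and L: "0 \<le> L"
    and \<eta>: "0 < \<eta>" "L \<le> 1 / (2 * \<eta>)"
    and start: "z 0 = z (-1)"
    and step: "\<And>k. k \<ge> 0 \<Longrightarrow> z (k + 1) = z k - (2 * \<eta>) *\<^sub>R F (z k) + \<eta> *\<^sub>R F (z (k - 1))"
    and mono: "\<And>p. 0 \<le> F p \<bullet> (p - w)"
    and k: "k \<ge> 0"
  shows "(norm (z k - w))\<^sup>2 \<le> 2 * (norm (z 0 - w))\<^sup>2"
proof -
  define E where "E j = 1 / (2 * \<eta>) * (norm (z j - w))\<^sup>2 + L / 2 * (norm (z j - z (j - 1)))\<^sup>2
      - (F (z j) - F (z (j - 1))) \<bullet> (z j - w)" for j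
  have "E k \<le> E 0"
    using k
  proof (induction k rule: int_ge_induct)
    case base
    show ?case by simp
  next
    case (step i)
    have "E (i + 1) \<le> E i"
      using ogda_step_inequality[OF lip L \<eta> assms(6)[OF step.hyps], of w] mono[of "z (i + 1)"]
      by (simp add: E_def)
    with step.IH show ?case by linarith
  qed
  also have "E 0 = 1 / (2 * \<eta>) * (norm (z 0 - w))\<^sup>2"
    using start by (simp add: E_def)
  finally have "E k \<le> 1 / (2 * \<eta>) * (norm (z 0 - w))\<^sup>2" .
  moreover have "(F (z k) - F (z (k - 1))) \<bullet> (z k - w)
      \<le> L / 2 * (norm (z k - z (k - 1)))\<^sup>2 + L / 2 * (norm (z k - w))\<^sup>2"
    using inner_lipschitz_diff_bound[of F "z k" "z (k - 1)" L "z k - w", OF lip L] by linarith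
  moreover have "L * (norm (z k - w))\<^sup>2 \<le> 1 / (2 * \<eta>) * (norm (z k - w))\<^sup>2"
    by (intro mult_right_mono \<eta>(2)) simp
  ultimately have "1 / (2 * \<eta>) * (norm (z k - w))\<^sup>2 \<le> 2 * (1 / (2 * \<eta>) * (norm (z 0 - w))\<^sup>2)"
    unfolding E_def by linarith
  then show ?thesis
    using \<eta>(1) by (simp add: field_simps)
qed

lemma compact_prod_sq_dist_le:
  fixes a :: "'a::euclidean_space" and b :: "'b::euclidean_space"
  shows "compact {(x, y). (norm (x - a))\<^sup>2 + (norm (y - b))\<^sup>2 \<le> c}"
proof -
  have "dist (a, b) (x, y) = sqrt ((norm (x - a))\<^sup>2 + (norm (y - b))\<^sup>2)" for x y
    unfolding dist_Pair_Pair by (simp add: dist_norm norm_minus_commute)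
  then have "{(x, y). (norm (x - a))\<^sup>2 + (norm (y - b))\<^sup>2 \<le> c} = cball (a, b) (sqrt c)"
    by auto
  then show ?thesis by simp
qed

theorem lemma2:
  fixes f :: "(real ^ 'm) \<times> (real ^ 'n) \<Rightarrow> real"
    and Lxx Lxy Lyx Lyy L \<eta> :: real
    and F :: "(real ^ 'm) \<times> (real ^ 'n) \<Rightarrow> (real ^ 'm) \<times> (real ^ 'n)"
    and z :: "int \<Rightarrow> (real ^ 'm) \<times> (real ^ 'n)"
  assumes "continuously_differentiable f"
    and "convex_concave f"
    and "\<And>x1 x2 y. norm (grad_x f x1 y - grad_x f x2 y) \<le> Lxx * norm (x1 - x2)"
    and "\<And>x y1 y2. norm (grad_x f x y1 - grad_x f x y2) \<le> Lxy * norm (y1 - y2)"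
    and "\<And>x y1 y2. norm (grad_y f x y1 - grad_y f x y2) \<le> Lyy * norm (y1 - y2)"
    and "\<And>x1 x2 y. norm (grad_y f x1 y - grad_y f x2 y) \<le> Lyx * norm (x1 - x2)"
    and "L = 2 * Max {Lxx, Lxy, Lyx, Lyy}"
    and "saddle_points f \<noteq> {}"
    and "F = saddle_operator f"
    and "ogda_iterates f \<eta> z"
    and "0 < \<eta>"
    (* for L = 0 the bound 1/(2L) is read as infinity *)
    and "L \<noteq> 0 \<Longrightarrow> \<eta> \<le> 1 / (2 * L)"
  shows "(\<forall>w. \<forall>k\<ge>0.
           F (z (k + 1)) \<bullet> (z (k + 1) - w) \<le>
             1 / (2 * \<eta>) * (norm (z k - w))\<^sup>2 - 1 / (2 * \<eta>) * (norm (z (k + 1) - w))\<^sup>2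
             - L / 2 * (norm (z (k + 1) - z k))\<^sup>2 + L / 2 * (norm (z k - z (k - 1)))\<^sup>2
             + (F (z (k + 1)) - F (z k)) \<bullet> (z (k + 1) - w)
             - (F (z k) - F (z (k - 1))) \<bullet> (z k - w)) \<and>
         (\<forall>(xs, ys) \<in> saddle_points f.
           let D = {(x, y). (norm (x - xs))\<^sup>2 + (norm (y - ys))\<^sup>2 \<le>
                      2 * ((norm (fst (z 0) - xs))\<^sup>2 + (norm (snd (z 0) - ys))\<^sup>2)}
           in compact D \<and> (\<forall>k\<ge>0. z k \<in> D))"
proof -
  define M where "M = Max {Lxx, Lxy, Lyx, Lyy}"
  have L2M: "L = 2 * M" by (simp add: M_def assms(7))
  have le: "Lxx \<le> M" "Lxy \<le> M" "Lyx \<le> M" "Lyy \<le> M" by (simp_all add: M_def)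
  (* Comparing two points at distance 1 shows that a Lipschitz constant cannot be negative. *)
  obtain e :: "real ^ 'm" where "norm e = 1"
    using norm_Basis[OF SOME_Basis] by blast
  then have "0 \<le> Lxx"
    using order_trans[OF norm_ge_zero assms(3)[of e undefined 0]] by simp
  then have M: "0 \<le> M" and L: "0 \<le> L" using le(1) by (simp_all add: L2M)
  have lip: "norm (F p - F q) \<le> L * norm (p - q)" for p q
    unfolding assms(9) L2M
    by (rule saddle_operator_lipschitz;
        (rule M | rule order_trans[OF assms(3) mult_right_mono[OF le(1)]]
         | rule order_trans[OF assms(4) mult_right_mono[OF le(2)]]
         | rule order_trans[OF assms(5) mult_right_mono[OF le(4)]]
         | rule order_trans[OF assms(6) mult_right_mono[OF le(3)]]); simp)
  have \<eta>: "L \<le> 1 / (2 * \<eta>)"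
    using assms(11,12) L by (cases "L = 0") (auto simp: field_simps)
  have start: "z 0 = z (-1)"
    and step: "\<And>k. k \<ge> 0 \<Longrightarrow> z (k + 1) = z k - (2 * \<eta>) *\<^sub>R F (z k) + \<eta> *\<^sub>R F (z (k - 1))"
    using assms(9,10) by (auto simp: ogda_iterates_def)
  show ?thesis
  proof (intro conjI allI impI ballI)
    fix w k assume "0 \<le> (k::int)"
    then show "F (z (k + 1)) \<bullet> (z (k + 1) - w) \<le>
             1 / (2 * \<eta>) * (norm (z k - w))\<^sup>2 - 1 / (2 * \<eta>) * (norm (z (k + 1) - w))\<^sup>2
             - L / 2 * (norm (z (k + 1) - z k))\<^sup>2 + L / 2 * (norm (z k - z (k - 1)))\<^sup>2
             + (F (z (k + 1)) - F (z k)) \<bullet> (z (k + 1) - w)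
             - (F (z k) - F (z (k - 1))) \<bullet> (z k - w)"
      by (intro ogda_step_inequality lip L assms(11) \<eta> step)
  next
    fix s assume "s \<in> saddle_points f"
    moreover obtain xs ys where s: "s = (xs, ys)" by (cases s)
    ultimately have "\<And>p. 0 \<le> F p \<bullet> (p - (xs, ys))"
      unfolding assms(9)
      by (intro saddle_operator_inner_saddle_point_nonneg assms(1,2)) simp
    from ogda_dist_bound[OF lip L assms(11) \<eta> start step this]
    have bound: "(norm (z k - (xs, ys)))\<^sup>2 \<le> 2 * (norm (z 0 - (xs, ys)))\<^sup>2" if "k \<ge> 0" for k
      using that by blast
    have sq: "(norm (p - (xs, ys)))\<^sup>2 = (norm (fst p - xs))\<^sup>2 + (norm (snd p - ys))\<^sup>2" for p
      by (cases p) (simp add: norm_Pair)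
    show "case s of (xs, ys) \<Rightarrow>
           let D = {(x, y). (norm (x - xs))\<^sup>2 + (norm (y - ys))\<^sup>2 \<le>
                      2 * ((norm (fst (z 0) - xs))\<^sup>2 + (norm (snd (z 0) - ys))\<^sup>2)}
           in compact D \<and> (\<forall>k\<ge>0. z k \<in> D)"
      using bound unfolding sq s
      by (simp add: Let_def compact_prod_sq_dist_le case_prod_beta)
  qed
qed

end
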